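(* For a semigroup $X$ the following conditions are equivalent: (1) $X$ is a finite linear semilattice; (2) $\upsilon(X)$ is a semilattice; (3) $\lambda(X)$ is a semilattice; (4) $\varphi(X)$ is a semilattice.
   Context: A semilattice is a commutative semigroup with $xx=x$ for all $x$. A semigroup $S$ is linear if $xy\in\{x,y\}$ for all $x,y\in S$. For a set $X$, an upfamily on $X$ is a non-empty family $\mathcal F$ of non-empty subsets of $X$ such that $A\in\mathcal F$ and $A\subset B\subset X$ imply $B\in\mathcal F$; $\upsilon(X)$ is the set of all upfamilies on $X$. For a family $\mathcal B$ of subsets of $X$, $\langle\mathcal B\rangle=\{A\subset X:\exists B\in\mathcal B,\ B\subset A\}$. An upfamily $\mathcal A$ is a filter if $A_1\cap A_2\in\mathcal A$ for all $A_1,A_2\in\mathcal A$; linked if $A\cap B\neq\emptyset$ for all $A,B\in\mathcal A$; maximal linked if it is linked and is not properly contained in another linked upfamily. $\varphi(X)$ and $\lambda(X)$ are the sets of all filters and of all maximal linked upfamilies on $X$, respectively. If $X$ is a semigroup, the operation of $X$ is extended to $\upsilon(X)$ by $\mathcal U*\mathcal V=\big\langle\bigcup_{x\in U}xV_x: U\in\mathcal U,\ (V_x)_{x\in U}\in\mathcal V^U\big\rangle$. This makes $\upsilon(X)$ a semigroup, with $\varphi(X)$ and $\lambda(X)$ as subsemigroups. *)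

theory Defs
  imports Main
begin

definition semigroup_on :: "'a set \<Rightarrow> ('a \<Rightarrow> 'a \<Rightarrow> 'a) \<Rightarrow> bool" where
  "semigroup_on S f \<longleftrightarrow>
     (\<forall>x\<in>S. \<forall>y\<in>S. f x y \<in> S) \<and>
     (\<forall>x\<in>S. \<forall>y\<in>S. \<forall>z\<in>S. f (f x y) z = f x (f y z))"

definition semilattice_on :: "'a set \<Rightarrow> ('a \<Rightarrow> 'a \<Rightarrow> 'a) \<Rightarrow> bool" where
  "semilattice_on S f \<longleftrightarrow>
     semigroup_on S f \<and>
     (\<forall>x\<in>S. \<forall>y\<in>S. f x y = f y x) \<and>
     (\<forall>x\<in>S. f x x = x)"

definition linear_on :: "'a set \<Rightarrow> ('a \<Rightarrow> 'a \<Rightarrow> 'a) \<Rightarrow> bool" where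
  "linear_on S f \<longleftrightarrow> (\<forall>x\<in>S. \<forall>y\<in>S. f x y \<in> {x, y})"

definition upfamily :: "'a set \<Rightarrow> 'a set set \<Rightarrow> bool" where
  "upfamily X F \<longleftrightarrow>
     F \<noteq> {} \<and>
     (\<forall>A\<in>F. A \<noteq> {} \<and> A \<subseteq> X) \<and>
     (\<forall>A B. A \<in> F \<and> A \<subseteq> B \<and> B \<subseteq> X \<longrightarrow> B \<in> F)"

definition linked :: "'a set set \<Rightarrow> bool" where
  "linked F \<longleftrightarrow> (\<forall>A\<in>F. \<forall>B\<in>F. A \<inter> B \<noteq> {})"

definition upfamilies :: "'a set \<Rightarrow> 'a set set set" where
  "upfamilies X = {F. upfamily X F}"

definition filters :: "'a set \<Rightarrow> 'a set set set" where
  "filters X = {F. upfamily X F \<and> (\<forall>A\<in>F. \<forall>B\<in>F. A \<inter> B \<in> F)}"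

definition max_linked :: "'a set \<Rightarrow> 'a set set set" where
  "max_linked X = {F. upfamily X F \<and> linked F \<and>
     \<not> (\<exists>G. upfamily X G \<and> linked G \<and> F \<subset> G)}"

definition up_closure :: "'a set \<Rightarrow> 'a set set \<Rightarrow> 'a set set" where
  "up_closure X \<B> = {A. A \<subseteq> X \<and> (\<exists>B\<in>\<B>. B \<subseteq> A)}"

(* A family (V_x) indexed by x in A is represented by a total function V;
   its values outside A are irrelevant. *)
definition up_mult ::
  "'a set \<Rightarrow> ('a \<Rightarrow> 'a \<Rightarrow> 'a) \<Rightarrow> 'a set set \<Rightarrow> 'a set set \<Rightarrow> 'a set set" where
  "up_mult X f \<U> \<V> =
     up_closure X {\<Union>x\<in>A. f x ` V x | A V. A \<in> \<U> \<and> (\<forall>x\<in>A. V x \<in> \<V>)}"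

end

theory Submission imports Defs "HOL-Library.Ramsey" begin

text \<open>
  The products in \<open>\<upsilon>(X)\<close> are handled through a membership test without
  existential quantifiers: \<open>A\<close> belongs to \<open>\<U> * \<V>\<close> iff the set of all \<open>x\<close> with
  \<open>{y. xy \<in> A} \<in> \<V>\<close> belongs to \<open>\<U>\<close> (\<open>mem_up_mult\<close>). Associativity and the fact that
  \<open>\<phi>(X)\<close> and \<open>\<lambda>(X)\<close> are closed under the product can be read off from this test, once maximal
  linked upfamilies are recognised as the linked upfamilies that contain \<open>A\<close> or \<open>X - A\<close> for
  each \<open>A \<subseteq> X\<close>.

  A linear semilattice is a chain with \<open>xy = min x y\<close>. Over a finite chain, membership of \<open>A\<close> in
  \<open>\<U> * \<V>\<close> amounts to the existence of a threshold \<open>c \<in> A\<close> such that one of the two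
  upfamilies contains the part of \<open>A\<close> up to \<open>c\<close>, and the other contains \<open>A\<close> enlarged by
  everything above \<open>c\<close> (\<open>mem_up_mult_chain\<close>). This condition is symmetric in \<open>\<U>\<close> and
  \<open>\<V>\<close>, so \<open>\<upsilon>(X)\<close> is commutative; idempotence is direct. The properties are inherited by
  \<open>\<lambda>(X)\<close> and \<open>\<phi>(X)\<close>.

  Conversely, \<open>X\<close> embeds in both \<open>\<lambda>(X)\<close> and \<open>\<phi>(X)\<close> by principal upfamilies, so \<open>X\<close> is a
  semilattice as soon as one of them is. If \<open>xy\<close> were different from \<open>x\<close> and \<open>y\<close>, then
  the filter generated by \<open>{x, y}\<close> and the majority family on \<open>{x, y, xy}\<close> would not be
  idempotent; hence \<open>X\<close> is linear. If \<open>X\<close> were infinite, Ramsey's theorem would give an infinite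
  strictly monotone sequence in the chain \<open>X\<close>. Take one upfamily that concentrates on its even
  tails and another that concentrates on its odd tails. One of the sets of even and odd terms
  belongs to their product in one order, the other set to the product in the other order. If the
  two products were equal, the product would contain two disjoint sets, although all members of
  \<open>\<lambda>(X)\<close> and \<open>\<phi>(X)\<close> are linked (\<open>finite_if_commuting_linked\<close>).
\<close>


section \<open>The product of upfamilies\<close>

lemma upfamily_mono: "upfamily X F \<Longrightarrow> A \<in> F \<Longrightarrow> A \<subseteq> B \<Longrightarrow> B \<subseteq> X \<Longrightarrow> B \<in> F"
  unfolding upfamily_def by blast

lemma upfamily_subset: "upfamily X F \<Longrightarrow> A \<in> F \<Longrightarrow> A \<subseteq> X"
  unfolding upfamily_def by blast

lemma upfamily_nonempty: "upfamily X F \<Longrightarrow> A \<in> F \<Longrightarrow> A \<noteq> {}"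
  unfolding upfamily_def by blast

lemma upfamily_carrier: "upfamily X F \<Longrightarrow> X \<in> F"
  unfolding upfamily_def by blast

lemma filter_linked: "F \<in> filters X \<Longrightarrow> linked F"
  unfolding filters_def linked_def upfamily_def by blast

definition translates_in ::
  "'a set \<Rightarrow> ('a \<Rightarrow> 'a \<Rightarrow> 'a) \<Rightarrow> 'a set \<Rightarrow> 'a set set \<Rightarrow> 'a set" where
  "translates_in X f A \<V> = {x \<in> X. {y \<in> X. f x y \<in> A} \<in> \<V>}"

text \<open>For a given \<open>A\<close> the best choice of \<open>V\<^sub>x\<close> is the largest one, the set of all
  \<open>y\<close> with \<open>xy \<in> A\<close>, and the best \<open>U\<close> consists of all \<open>x\<close> for which this choice is
  admissible.\<close>
lemma mem_up_mult:
  assumes U: "upfamily X \<U>" and V: "upfamily X \<V>"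
  shows "A \<in> up_mult X f \<U> \<V> \<longleftrightarrow> A \<subseteq> X \<and> translates_in X f A \<V> \<in> \<U>"
proof
  assume "A \<in> up_mult X f \<U> \<V>"
  then obtain B W where A: "A \<subseteq> X" and B: "B \<in> \<U>" and W: "\<forall>x\<in>B. W x \<in> \<V>"
    and sub: "(\<Union>x\<in>B. f x ` W x) \<subseteq> A"
    unfolding up_mult_def up_closure_def by blast
  have "x \<in> translates_in X f A \<V>" if x: "x \<in> B" for x
  proof -
    have "W x \<subseteq> {y \<in> X. f x y \<in> A}"
      using sub x W upfamily_subset[OF V] by blast
    then have "{y \<in> X. f x y \<in> A} \<in> \<V>"
      using upfamily_mono[OF V] W x by (metis (no_types, lifting) mem_Collect_eq subsetI)
    then show ?thesis
      using x B upfamily_subset[OF U] unfolding translates_in_def by blast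
  qed
  then have "translates_in X f A \<V> \<in> \<U>"
    using upfamily_mono[OF U B] unfolding translates_in_def by blast
  with A show "A \<subseteq> X \<and> translates_in X f A \<V> \<in> \<U>" by blast
next
  assume A: "A \<subseteq> X \<and> translates_in X f A \<V> \<in> \<U>"
  let ?W = "\<lambda>x. {y \<in> X. f x y \<in> A}"
  have "(\<Union>x\<in>translates_in X f A \<V>. f x ` ?W x) \<subseteq> A" by blast
  moreover have "\<forall>x\<in>translates_in X f A \<V>. ?W x \<in> \<V>"
    unfolding translates_in_def by blast
  ultimately have "\<exists>B\<in>{\<Union>x\<in>B. f x ` W x | B W. B \<in> \<U> \<and> (\<forall>x\<in>B. W x \<in> \<V>)}. B \<subseteq> A"
    using A by (intro bexI[OF _ CollectI] exI conjI) auto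
  then show "A \<in> up_mult X f \<U> \<V>"
    using A unfolding up_mult_def up_closure_def by simp
qed

lemma translates_in_mono:
  assumes V: "upfamily X \<V>" and "A \<subseteq> B"
  shows "translates_in X f A \<V> \<subseteq> translates_in X f B \<V>"
proof
  fix x assume x: "x \<in> translates_in X f A \<V>"
  have "{y \<in> X. f x y \<in> A} \<subseteq> {y \<in> X. f x y \<in> B}"
    using \<open>A \<subseteq> B\<close> by blast
  with x show "x \<in> translates_in X f B \<V>"
    unfolding translates_in_def using upfamily_mono[OF V] by auto
qed

lemma translates_in_subset: "translates_in X f A \<V> \<subseteq> X"
  unfolding translates_in_def by blast

lemma translates_in_carrier:
  assumes "semigroup_on X f" "upfamily X \<V>"
  shows "translates_in X f X \<V> = X"
proof -
  have "{y \<in> X. f x y \<in> X} = X" if "x \<in> X" for x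
    using assms(1) that unfolding semigroup_on_def by blast
  then show ?thesis
    using upfamily_carrier[OF assms(2)] unfolding translates_in_def by auto
qed

lemma upfamily_up_mult:
  assumes S: "semigroup_on X f" and U: "upfamily X \<U>" and V: "upfamily X \<V>"
  shows "upfamily X (up_mult X f \<U> \<V>)"
  unfolding upfamily_def
proof (intro conjI ballI allI impI)
  have "X \<in> up_mult X f \<U> \<V>"
    using mem_up_mult[OF U V] translates_in_carrier[OF S V] upfamily_carrier[OF U] by auto
  then show "up_mult X f \<U> \<V> \<noteq> {}" by blast
next
  fix A assume A: "A \<in> up_mult X f \<U> \<V>"
  then show "A \<subseteq> X" using mem_up_mult[OF U V] by blast
  have "translates_in X f A \<V> \<noteq> {}"
    using A mem_up_mult[OF U V] upfamily_nonempty[OF U] by blast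
  then obtain x where "{y \<in> X. f x y \<in> A} \<in> \<V>" unfolding translates_in_def by blast
  then have "{y \<in> X. f x y \<in> A} \<noteq> {}" using upfamily_nonempty[OF V] by blast
  then show "A \<noteq> {}" by blast
next
  fix A B assume "A \<in> up_mult X f \<U> \<V> \<and> A \<subseteq> B \<and> B \<subseteq> X"
  then show "B \<in> up_mult X f \<U> \<V>"
    using mem_up_mult[OF U V] upfamily_mono[OF U] translates_in_mono[OF V]
      translates_in_subset by metis
qed

text \<open>Both bracketings of \<open>\<U> * \<V> * \<W>\<close> test whether \<open>\<U>\<close>-many \<open>x\<close>, for each of them
  \<open>\<V>\<close>-many \<open>y\<close>, and for each of these \<open>\<W>\<close>-many \<open>z\<close> satisfy \<open>xyz \<in> A\<close>.\<close>
lemma up_mult_assoc: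
  assumes S: "semigroup_on X f"
    and U: "upfamily X \<U>" and V: "upfamily X \<V>" and W: "upfamily X \<W>"
  shows "up_mult X f (up_mult X f \<U> \<V>) \<W> = up_mult X f \<U> (up_mult X f \<V> \<W>)"
proof (rule set_eqI)
  fix A
  have "translates_in X f (translates_in X f A \<W>) \<V> =
        translates_in X f A (up_mult X f \<V> \<W>)"
  proof -
    have "{y \<in> X. f x y \<in> translates_in X f A \<W>} =
          translates_in X f {w \<in> X. f x w \<in> A} \<W>" if x: "x \<in> X" for x
    proof -
      have "{z \<in> X. f (f x y) z \<in> A} = {z \<in> X. f y z \<in> {w \<in> X. f x w \<in> A}}" if "y \<in> X" for y
        using S x that unfolding semigroup_on_def by auto
      moreover have "f x y \<in> X" if "y \<in> X" for y
        using S x that unfolding semigroup_on_def by blast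
      ultimately show ?thesis unfolding translates_in_def by auto
    qed
    then show ?thesis
      unfolding translates_in_def[of X f "translates_in X f A \<W>"]
        translates_in_def[of X f A "up_mult X f \<V> \<W>"]
      by (auto simp: mem_up_mult[OF V W])
  qed
  then show "A \<in> up_mult X f (up_mult X f \<U> \<V>) \<W> \<longleftrightarrow>
             A \<in> up_mult X f \<U> (up_mult X f \<V> \<W>)"
    unfolding mem_up_mult[OF upfamily_up_mult[OF S U V] W] mem_up_mult[OF U V]
      mem_up_mult[OF U upfamily_up_mult[OF S V W]]
    using translates_in_subset[of X f A \<W>] by simp
qed

lemma semigroup_upfamilies:
  assumes "semigroup_on X f"
  shows "semigroup_on (upfamilies X) (up_mult X f)"
  unfolding semigroup_on_def[of "upfamilies X"]
proof (intro conjI ballI)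
  fix \<U> \<V> assume "\<U> \<in> upfamilies X" "\<V> \<in> upfamilies X"
  then show "up_mult X f \<U> \<V> \<in> upfamilies X"
    using upfamily_up_mult[OF assms] by (simp add: upfamilies_def)
next
  fix \<U> \<V> \<W>
  assume "\<U> \<in> upfamilies X" "\<V> \<in> upfamilies X" "\<W> \<in> upfamilies X"
  then show "up_mult X f (up_mult X f \<U> \<V>) \<W> = up_mult X f \<U> (up_mult X f \<V> \<W>)"
    by (intro up_mult_assoc[OF assms]) (simp_all add: upfamilies_def)
qed


section \<open>Filters and maximal linked upfamilies\<close>

text \<open>A set that meets all members of a linked upfamily \<open>F\<close> can be added to \<open>F\<close> without
  losing linkedness. So if \<open>F\<close> is maximal and does not contain \<open>A\<close>, some member of \<open>F\<close> misses
  \<open>A\<close> and witnesses \<open>X - A \<in> F\<close>.\<close>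
lemma mem_max_linked:
  "F \<in> max_linked X \<longleftrightarrow>
     upfamily X F \<and> linked F \<and> (\<forall>A. A \<subseteq> X \<longrightarrow> A \<in> F \<or> X - A \<in> F)"
proof
  assume F: "F \<in> max_linked X"
  then have up: "upfamily X F" and li: "linked F"
    and mx: "\<And>G. upfamily X G \<Longrightarrow> linked G \<Longrightarrow> F \<subseteq> G \<Longrightarrow> F = G"
    unfolding max_linked_def by blast+
  have "X - A \<in> F" if A: "A \<subseteq> X" "A \<notin> F" for A
  proof (rule ccontr)
    assume "X - A \<notin> F"
    then have meets: "B \<inter> A \<noteq> {}" if "B \<in> F" for B
      using upfamily_mono[OF up that, of "X - A"] upfamily_subset[OF up that] by blast
    let ?G = "F \<union> {D. D \<subseteq> X \<and> A \<subseteq> D}"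
    have "A \<noteq> {}" using meets[OF upfamily_carrier[OF up]] by blast
    then have "\<forall>D\<in>?G. D \<noteq> {} \<and> D \<subseteq> X"
      using upfamily_nonempty[OF up] upfamily_subset[OF up] by blast
    moreover have "\<forall>D E. D \<in> ?G \<and> D \<subseteq> E \<and> E \<subseteq> X \<longrightarrow> E \<in> ?G"
      using upfamily_mono[OF up] by blast
    moreover have "?G \<noteq> {}" using A by blast
    ultimately have "upfamily X ?G" unfolding upfamily_def by blast
    moreover have "linked ?G"
      unfolding linked_def
    proof (intro ballI)
      fix B C assume "B \<in> ?G" "C \<in> ?G"
      then consider "B \<in> F" "C \<in> F" | "B \<in> F" "A \<subseteq> C" | "A \<subseteq> B" "C \<in> F" | "A \<subseteq> B" "A \<subseteq> C"
        by blast
      then show "B \<inter> C \<noteq> {}"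
      proof cases
        case 1
        then show ?thesis using li unfolding linked_def by blast
      next
        case 2
        then show ?thesis using meets[of B] by blast
      next
        case 3
        then show ?thesis using meets[of C] by blast
      next
        case 4
        then show ?thesis using \<open>A \<noteq> {}\<close> by blast
      qed
    qed
    ultimately have "F = ?G" using mx[of ?G] by simp
    moreover have "A \<in> ?G" using A by simp
    ultimately show False using A by simp
  qed
  with up li show "upfamily X F \<and> linked F \<and> (\<forall>A. A \<subseteq> X \<longrightarrow> A \<in> F \<or> X - A \<in> F)" by blast
next
  assume F: "upfamily X F \<and> linked F \<and> (\<forall>A. A \<subseteq> X \<longrightarrow> A \<in> F \<or> X - A \<in> F)"
  have "G \<subseteq> F" if "upfamily X G" "linked G" "F \<subseteq> G" for G
  proof
    fix A assume A: "A \<in> G"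
    then have "A \<subseteq> X" using that upfamily_subset by blast
    moreover have "X - A \<notin> G" using A that(2) unfolding linked_def by blast
    ultimately show "A \<in> F" using F that(3) by blast
  qed
  with F show "F \<in> max_linked X" unfolding max_linked_def by blast
qed

lemma linked_extends_to_max_linked:
  assumes F: "upfamily X F" "linked F"
  shows "\<exists>M \<in> max_linked X. F \<subseteq> M"
proof -
  let ?P = "{G. upfamily X G \<and> linked G \<and> F \<subseteq> G}"
  have "\<exists>M\<in>?P. \<forall>G\<in>?P. M \<subseteq> G \<longrightarrow> G = M"
  proof (rule subset_Zorn_nonempty)
    show "?P \<noteq> {}" using F by blast
  next
    fix \<C> assume ne: "\<C> \<noteq> {}" and ch: "subset.chain ?P \<C>"
    have mem: "\<And>G. G \<in> \<C> \<Longrightarrow> upfamily X G \<and> linked G \<and> F \<subseteq> G"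
      and cmp: "\<And>G H. G \<in> \<C> \<Longrightarrow> H \<in> \<C> \<Longrightarrow> G \<subseteq> H \<or> H \<subseteq> G"
      using ch unfolding subset_chain_def by blast+
    have "F \<subseteq> \<Union>\<C>" using ne mem by blast
    moreover have "upfamily X (\<Union>\<C>)"
    proof -
      have up: "upfamily X G" if "G \<in> \<C>" for G using mem that by blast
      have "\<Union>\<C> \<noteq> {}" using upfamily_carrier[OF F(1)] \<open>F \<subseteq> \<Union>\<C>\<close> by blast
      moreover have "\<forall>A\<in>\<Union>\<C>. A \<noteq> {} \<and> A \<subseteq> X"
        using upfamily_nonempty[OF up] upfamily_subset[OF up] by blast
      moreover have "\<forall>A B. A \<in> \<Union>\<C> \<and> A \<subseteq> B \<and> B \<subseteq> X \<longrightarrow> B \<in> \<Union>\<C>"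
        using upfamily_mono[OF up] by blast
      ultimately show ?thesis unfolding upfamily_def by blast
    qed
    moreover have "linked (\<Union>\<C>)"
      unfolding linked_def
    proof (intro ballI)
      fix A B assume "A \<in> \<Union>\<C>" "B \<in> \<Union>\<C>"
      then obtain G H where GH: "G \<in> \<C>" "A \<in> G" "H \<in> \<C>" "B \<in> H" by blast
      then show "A \<inter> B \<noteq> {}"
        using cmp[of G H] mem[of G] mem[of H] unfolding linked_def by blast
    qed
    ultimately show "\<Union>\<C> \<in> ?P" by blast
  qed
  then obtain M where M: "M \<in> ?P" "\<forall>G\<in>?P. M \<subseteq> G \<longrightarrow> G = M" by blast
  then have "M \<in> max_linked X" unfolding max_linked_def by blast
  with M show ?thesis by blast
qed

lemma filters_up_mult:
  assumes S: "semigroup_on X f" and U: "\<U> \<in> filters X" and V: "\<V> \<in> filters X"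
  shows "up_mult X f \<U> \<V> \<in> filters X"
proof -
  have u: "upfamily X \<U>" and v: "upfamily X \<V>" using U V unfolding filters_def by auto
  have "A \<inter> B \<in> up_mult X f \<U> \<V>"
    if A: "A \<in> up_mult X f \<U> \<V>" and B: "B \<in> up_mult X f \<U> \<V>" for A B
  proof -
    have "{y \<in> X. f x y \<in> A \<inter> B} = {y \<in> X. f x y \<in> A} \<inter> {y \<in> X. f x y \<in> B}" for x by blast
    then have "translates_in X f A \<V> \<inter> translates_in X f B \<V> \<subseteq> translates_in X f (A \<inter> B) \<V>"
      using V unfolding translates_in_def filters_def by auto
    moreover have "translates_in X f A \<V> \<inter> translates_in X f B \<V> \<in> \<U>"
      using A B U mem_up_mult[OF u v] unfolding filters_def by blast
    ultimately have "translates_in X f (A \<inter> B) \<V> \<in> \<U>"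
      using upfamily_mono[OF u _ _ translates_in_subset] by blast
    moreover have "A \<inter> B \<subseteq> X" using A mem_up_mult[OF u v] by auto
    ultimately show ?thesis using mem_up_mult[OF u v] by simp
  qed
  with upfamily_up_mult[OF S u v] show ?thesis unfolding filters_def by simp
qed

text \<open>Forming \<open>translates_in\<close> with respect to a maximal linked upfamily commutes with
  complements, since such a family contains exactly one of any two complementary sets.\<close>
lemma max_linked_up_mult:
  assumes S: "semigroup_on X f" and U: "\<U> \<in> max_linked X" and V: "\<V> \<in> max_linked X"
  shows "up_mult X f \<U> \<V> \<in> max_linked X"
proof -
  have u: "upfamily X \<U>" "linked \<U>" "\<And>A. A \<subseteq> X \<Longrightarrow> A \<in> \<U> \<or> X - A \<in> \<U>"
    and v: "upfamily X \<V>" "linked \<V>" "\<And>A. A \<subseteq> X \<Longrightarrow> A \<in> \<V> \<or> X - A \<in> \<V>"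
    using U V unfolding mem_max_linked by blast+
  let ?T = "\<lambda>A. translates_in X f A \<V>"
  have "X - ?T A \<subseteq> ?T (X - A)" for A
  proof
    fix x assume x: "x \<in> X - ?T A"
    then have "X - {y \<in> X. f x y \<in> A} \<in> \<V>"
      using v(3)[of "{y \<in> X. f x y \<in> A}"] unfolding translates_in_def by blast
    moreover have "X - {y \<in> X. f x y \<in> A} = {y \<in> X. f x y \<in> X - A}"
      using S x unfolding semigroup_on_def by blast
    ultimately show "x \<in> ?T (X - A)" using x unfolding translates_in_def by auto
  qed
  then have "?T A \<in> \<U> \<or> ?T (X - A) \<in> \<U>" for A
    using u(3)[OF translates_in_subset, of f A \<V>]
      upfamily_mono[OF u(1) _ _ translates_in_subset] by metis
  then have compl: "A \<in> up_mult X f \<U> \<V> \<or> X - A \<in> up_mult X f \<U> \<V>" if "A \<subseteq> X" for A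
    using that by (auto simp: mem_up_mult[OF u(1) v(1)])
  have "linked (up_mult X f \<U> \<V>)"
    unfolding linked_def
  proof (intro ballI)
    fix A B assume "A \<in> up_mult X f \<U> \<V>" "B \<in> up_mult X f \<U> \<V>"
    then have "?T A \<inter> ?T B \<noteq> {}"
      using u(2) mem_up_mult[OF u(1) v(1)] unfolding linked_def by blast
    then obtain x where "{y \<in> X. f x y \<in> A} \<in> \<V>" "{y \<in> X. f x y \<in> B} \<in> \<V>"
      unfolding translates_in_def by blast
    then have "{y \<in> X. f x y \<in> A} \<inter> {y \<in> X. f x y \<in> B} \<noteq> {}"
      using v(2) unfolding linked_def by blast
    then show "A \<inter> B \<noteq> {}" by blast
  qed
  with upfamily_up_mult[OF S u(1) v(1)] compl show ?thesis
    unfolding mem_max_linked by simp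
qed

lemma semilattice_on_subset:
  assumes "semilattice_on T g" "S \<subseteq> T" "\<And>x y. x \<in> S \<Longrightarrow> y \<in> S \<Longrightarrow> g x y \<in> S"
  shows "semilattice_on S g"
proof -
  have "semigroup_on S g"
    using assms unfolding semilattice_on_def semigroup_on_def by (meson subsetD)
  then show ?thesis
    using assms(1,2) unfolding semilattice_on_def by (meson subsetD)
qed


section \<open>Upfamilies on a finite chain\<close>

text \<open>The order of the chain is \<open>x \<le> y \<longleftrightarrow> xy = x\<close>.\<close>
lemma chain_extrema:
  assumes sl: "semilattice_on X f" and lin: "linear_on X f"
    and A: "finite A" "A \<noteq> {}" "A \<subseteq> X"
  obtains l g where "l \<in> A" "\<forall>x\<in>A. f l x = l" "g \<in> A" "\<forall>x\<in>A. f x g = x"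
proof -
  have assoc: "f (f x y) z = f x (f y z)" if "x \<in> X" "y \<in> X" "z \<in> X" for x y z
    using sl that unfolding semilattice_on_def semigroup_on_def by blast
  have com: "f x y = f y x" if "x \<in> X" "y \<in> X" for x y
    using sl that unfolding semilattice_on_def by blast
  have idem: "f x x = x" if "x \<in> X" for x
    using sl that unfolding semilattice_on_def by blast
  have "\<exists>l\<in>A. \<exists>g\<in>A. \<forall>x\<in>A. f l x = l \<and> f x g = x"
    using A
  proof (induction A rule: finite_ne_induct)
    case (singleton x)
    then show ?case using idem by auto
  next
    case (insert a A)
    then obtain l g where lg: "l \<in> A" "g \<in> A" "\<forall>x\<in>A. f l x = l \<and> f x g = x" by blast
    have X: "a \<in> X" "l \<in> X" "g \<in> X" "A \<subseteq> X" using lg insert by auto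
    have l': "\<exists>l'\<in>insert a A. \<forall>x\<in>insert a A. f l' x = l'"
    proof (cases "f l a = l")
      case True
      then show ?thesis using lg by blast
    next
      case False
      then have al: "f a l = a" using lin com X unfolding linear_on_def by (metis insertE singletonD)
      have "f a x = a" if "x \<in> A" for x
        using assoc[of a l x] al lg that X by auto
      then show ?thesis using idem X by blast
    qed
    have g': "\<exists>g'\<in>insert a A. \<forall>x\<in>insert a A. f x g' = x"
    proof (cases "f a g = a")
      case True
      then show ?thesis using lg by blast
    next
      case False
      then have ag: "f g a = g" using lin com X unfolding linear_on_def by (metis insertE singletonD)
      have "f x a = x" if "x \<in> A" for x
        using assoc[of x g a] ag lg that X by auto
      then show ?thesis using idem X by blast
    qed
    show ?case using l' g' by blast
  qed
  then show ?thesis using that by blast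
qed

text \<open>A characterisation of the product on a finite chain that is symmetric in the two factors.
  If the set \<open>D\<close> tested by \<open>mem_up_mult\<close> is contained in \<open>A\<close>, its greatest element is
  a threshold. Otherwise, for \<open>x \<in> D - A\<close> only the \<open>y < x\<close> with \<open>y \<in> A\<close> satisfy
  \<open>xy \<in> A\<close>; for the least such \<open>x\<close>, the greatest of these \<open>y\<close> is a threshold.\<close>
lemma mem_up_mult_chain:
  assumes fin: "finite X" and sl: "semilattice_on X f" and lin: "linear_on X f"
    and U: "upfamily X \<U>" and V: "upfamily X \<V>"
  shows "A \<in> up_mult X f \<U> \<V> \<longleftrightarrow> A \<subseteq> X \<and>
    (\<exists>c\<in>A. {x \<in> A. f x c = x} \<in> \<U> \<and> A \<union> {x \<in> X. f x c = c} \<in> \<V> \<or>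
           {x \<in> A. f x c = x} \<in> \<V> \<and> A \<union> {x \<in> X. f x c = c} \<in> \<U>)"
    (is "_ \<longleftrightarrow> _ \<and> (\<exists>c\<in>A. ?low c \<in> \<U> \<and> ?high c \<in> \<V> \<or> ?low c \<in> \<V> \<and> ?high c \<in> \<U>)")
proof (cases "A \<subseteq> X")
  case False
  then show ?thesis using mem_up_mult[OF U V] by blast
next
  case AX: True
  have assoc: "f (f x y) z = f x (f y z)" if "x \<in> X" "y \<in> X" "z \<in> X" for x y z
    using sl that unfolding semilattice_on_def semigroup_on_def by blast
  have com: "f x y = f y x" if "x \<in> X" "y \<in> X" for x y
    using sl that unfolding semilattice_on_def by blast
  have idem: "f x x = x" if "x \<in> X" for x
    using sl that unfolding semilattice_on_def by blast
  have lin': "f x y = x \<or> f x y = y" if "x \<in> X" "y \<in> X" for x y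
    using lin that unfolding linear_on_def by blast
  let ?D = "translates_in X f A \<V>"
  have "(\<exists>c\<in>A. ?low c \<in> \<U> \<and> ?high c \<in> \<V> \<or> ?low c \<in> \<V> \<and> ?high c \<in> \<U>)" if D: "?D \<in> \<U>"
  proof (cases "?D \<subseteq> A")
    case True
    obtain c where c: "c \<in> ?D" "\<forall>x\<in>?D. f x c = x"
      using chain_extrema[OF sl lin, of ?D] upfamily_nonempty[OF U D] fin
        finite_subset[OF translates_in_subset fin] translates_in_subset by metis
    have "?low c \<in> \<U>"
      using upfamily_mono[OF U D, of "?low c"] True c AX by blast
    moreover have "?high c \<in> \<V>"
    proof (rule upfamily_mono[OF V])
      show "{y \<in> X. f c y \<in> A} \<in> \<V>" using c unfolding translates_in_def by blast
      have cX: "c \<in> X" using c(1) unfolding translates_in_def by blast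
      show "{y \<in> X. f c y \<in> A} \<subseteq> ?high c"
      proof
        fix y assume y: "y \<in> {y \<in> X. f c y \<in> A}"
        then show "y \<in> ?high c" using lin'[OF cX, of y] com[OF cX, of y] by auto
      qed
    qed (use AX in blast)
    ultimately show ?thesis using c True by blast
  next
    case False
    have "finite (?D - A)" "?D - A \<subseteq> X" "?D - A \<noteq> {}"
      using False fin finite_subset translates_in_subset[of X f A \<V>] by blast+
    then obtain m where m: "m \<in> ?D - A" "\<forall>x\<in>?D - A. f m x = m"
      using chain_extrema[OF sl lin, of "?D - A"] by metis
    let ?B = "{y \<in> X. f m y \<in> A}"
    have B: "?B \<in> \<V>" and mX: "m \<in> X" using m unfolding translates_in_def by blast+
    have Bm: "y \<in> A" "f m y = y" if "y \<in> ?B" for y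
      using that m(1) lin'[OF mX, of y] by auto
    have "finite ?B" "?B \<subseteq> X" using fin by auto
    then obtain c where c: "c \<in> ?B" "\<forall>x\<in>?B. f x c = x"
      using chain_extrema[OF sl lin, of ?B] upfamily_nonempty[OF V B] by metis
    have "?low c \<in> \<V>"
      by (rule upfamily_mono[OF V B]) (use Bm c AX in blast)+
    moreover have "?high c \<in> \<U>"
    proof (rule upfamily_mono[OF U D])
      show "?D \<subseteq> ?high c"
      proof
        fix x assume x: "x \<in> ?D"
        then have xX: "x \<in> X" unfolding translates_in_def by blast
        have cX: "c \<in> X" using c by blast
        have "f x c = c" if "x \<notin> A"
        proof -
          have "f m x = m" using m x that by blast
          then show ?thesis using Bm(2)[OF c(1)] assoc[OF xX mX cX] com[OF xX mX] by simp
        qed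
        then show "x \<in> ?high c" using xX by blast
      qed
    qed (use AX in blast)
    ultimately show ?thesis using Bm c by blast
  qed
  moreover have "?D \<in> \<U>" if c: "c \<in> A" and "?low c \<in> \<U>" "?high c \<in> \<V>" for c
  proof (rule upfamily_mono[OF U])
    show "?low c \<in> \<U>" by fact
    show "?low c \<subseteq> ?D"
    proof
      fix x assume x: "x \<in> ?low c"
      have "?high c \<subseteq> {y \<in> X. f x y \<in> A}"
      proof
        fix y assume y: "y \<in> ?high c"
        have X: "x \<in> X" "y \<in> X" "c \<in> X" using x y c AX by auto
        have "f x y = x" if "f y c = c"
          using that x assoc[OF X(1,3,2)] com[OF X(2,3)] by auto
        then show "y \<in> {y \<in> X. f x y \<in> A}" using x y lin'[OF X(1,2)] X by auto
      qed
      then have "{y \<in> X. f x y \<in> A} \<in> \<V>"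
        using upfamily_mono[OF V \<open>?high c \<in> \<V>\<close>] by auto
      then show "x \<in> ?D" using x AX unfolding translates_in_def by blast
    qed
  qed (rule translates_in_subset)
  moreover have "?D \<in> \<U>" if c: "c \<in> A" and "?low c \<in> \<V>" "?high c \<in> \<U>" for c
  proof (rule upfamily_mono[OF U])
    show "?high c \<in> \<U>" by fact
    show "?high c \<subseteq> ?D"
    proof
      fix x assume x: "x \<in> ?high c"
      have "?low c \<subseteq> {y \<in> X. f x y \<in> A}"
      proof
        fix y assume y: "y \<in> ?low c"
        have X: "x \<in> X" "y \<in> X" "c \<in> X" using x y c AX by auto
        have "f x y = y" if "f x c = c"
          using that y assoc[OF X(1,3,2)] com[OF X(2,3)] by auto
        then show "y \<in> {y \<in> X. f x y \<in> A}" using x y lin'[OF X(1,2)] X by auto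
      qed
      then have "{y \<in> X. f x y \<in> A} \<in> \<V>"
        using upfamily_mono[OF V \<open>?low c \<in> \<V>\<close>] by auto
      then show "x \<in> ?D" using x AX unfolding translates_in_def by blast
    qed
  qed (rule translates_in_subset)
  ultimately show ?thesis using AX mem_up_mult[OF U V] by blast
qed

text \<open>If \<open>A \<in> \<U>\<close>, then \<open>AA \<subseteq> A\<close> by linearity, so \<open>A \<in> \<U> * \<U>\<close>. Conversely, the set
  tested by \<open>mem_up_mult\<close> lies in \<open>A\<close>, or it has an element \<open>x \<notin> A\<close>, and then
  \<open>xy \<in> A\<close> forces \<open>xy = y \<in> A\<close>.\<close>
lemma up_mult_idem:
  assumes lin: "linear_on X f" and U: "upfamily X \<U>"
  shows "up_mult X f \<U> \<U> = \<U>"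
proof (rule set_eqI)
  fix A
  have lin': "f x y = x \<or> f x y = y" if "x \<in> X" "y \<in> X" for x y
    using lin that unfolding linear_on_def by blast
  let ?D = "translates_in X f A \<U>"
  have "?D \<in> \<U>" if A: "A \<in> \<U>"
  proof (rule upfamily_mono[OF U A])
    have AX: "A \<subseteq> X" using A U upfamily_subset by blast
    have "A \<subseteq> {y \<in> X. f x y \<in> A}" if "x \<in> A" for x
      using that AX lin' by fastforce
    then have "{y \<in> X. f x y \<in> A} \<in> \<U>" if "x \<in> A" for x
      using that upfamily_mono[OF U A, of "{y \<in> X. f x y \<in> A}"] by auto
    then show "A \<subseteq> ?D" using AX unfolding translates_in_def by blast
  qed (rule translates_in_subset)
  moreover have "A \<in> \<U>" if A: "A \<subseteq> X" and D: "?D \<in> \<U>"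
  proof (cases "?D \<subseteq> A")
    case True
    then show ?thesis using upfamily_mono[OF U D] A by blast
  next
    case False
    then obtain x where x: "x \<in> X" "x \<notin> A" "{y \<in> X. f x y \<in> A} \<in> \<U>"
      unfolding translates_in_def by blast
    moreover have "{y \<in> X. f x y \<in> A} \<subseteq> A" using x lin' by fastforce
    ultimately show ?thesis using upfamily_mono[OF U] A by blast
  qed
  ultimately show "A \<in> up_mult X f \<U> \<U> \<longleftrightarrow> A \<in> \<U>"
    using mem_up_mult[OF U U] upfamily_subset[OF U] by blast
qed

lemma semilattice_upfamilies:
  assumes "finite X" "semilattice_on X f" "linear_on X f"
  shows "semilattice_on (upfamilies X) (up_mult X f)"
proof -
  have "semigroup_on X f" using assms(2) unfolding semilattice_on_def by blast
  moreover have "up_mult X f \<U> \<V> = up_mult X f \<V> \<U>"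
    if UV: "upfamily X \<U>" "upfamily X \<V>" for \<U> \<V>
    by (rule set_eqI)
      (simp only: mem_up_mult_chain[OF assms UV] mem_up_mult_chain[OF assms UV(2,1)] disj_commute)
  ultimately show ?thesis
    unfolding semilattice_on_def[of "upfamilies X"]
    by (simp add: semigroup_upfamilies) (simp add: upfamilies_def up_mult_idem[OF assms(3)])
qed


section \<open>The structure of the base semigroup\<close>

definition principal_at :: "'a set \<Rightarrow> 'a \<Rightarrow> 'a set set" where
  "principal_at X x = {A. A \<subseteq> X \<and> x \<in> A}"

lemma principal_upfamily: "x \<in> X \<Longrightarrow> upfamily X (principal_at X x)"
  unfolding principal_at_def upfamily_def by blast

lemma principal_filter: "x \<in> X \<Longrightarrow> principal_at X x \<in> filters X"
  using principal_upfamily[of x X] by (auto simp: filters_def principal_at_def)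

lemma principal_max_linked: "x \<in> X \<Longrightarrow> principal_at X x \<in> max_linked X"
  using principal_upfamily[of x X] by (auto simp: mem_max_linked linked_def principal_at_def)

lemma principal_eq_iff:
  assumes "x \<in> X" "y \<in> X"
  shows "principal_at X x = principal_at X y \<longleftrightarrow> x = y"
proof -
  have "{x} \<in> principal_at X y \<longleftrightarrow> x = y" "{x} \<in> principal_at X x"
    using assms unfolding principal_at_def by auto
  then show ?thesis by auto
qed

lemma up_mult_principal:
  assumes "x \<in> X" "y \<in> X"
  shows "up_mult X f (principal_at X x) (principal_at X y) = principal_at X (f x y)"
proof (rule set_eqI)
  fix A
  show "A \<in> up_mult X f (principal_at X x) (principal_at X y) \<longleftrightarrow> A \<in> principal_at X (f x y)"
    unfolding mem_up_mult[OF assms[THEN principal_upfamily]]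
    using assms by (auto simp: translates_in_def principal_at_def)
qed

lemma semilattice_base:
  assumes S: "semigroup_on X f" and K: "semilattice_on K (up_mult X f)"
    and pr: "\<And>x. x \<in> X \<Longrightarrow> principal_at X x \<in> K"
  shows "semilattice_on X f"
proof -
  have cl: "f x y \<in> X" if "x \<in> X" "y \<in> X" for x y
    using S that unfolding semigroup_on_def by blast
  have "f x y = f y x" if "x \<in> X" "y \<in> X" for x y
  proof -
    have "up_mult X f (principal_at X x) (principal_at X y) = up_mult X f (principal_at X y) (principal_at X x)"
      using K pr that unfolding semilattice_on_def by blast
    then show ?thesis
      using that cl by (simp add: up_mult_principal principal_eq_iff)
  qed
  moreover have "f x x = x" if "x \<in> X" for x
  proof -
    have "up_mult X f (principal_at X x) (principal_at X x) = principal_at X x"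
      using K pr that unfolding semilattice_on_def by blast
    then show ?thesis
      using that cl by (simp add: up_mult_principal principal_eq_iff)
  qed
  ultimately show ?thesis using S unfolding semilattice_on_def by blast
qed

text \<open>For the filter generated by \<open>{x, y}\<close>, idempotence puts \<open>{x, y}\<close> in the square of the
  filter, so \<open>{x, y}\<close> contains all products of two of its elements.\<close>
lemma linear_if_filters_idem:
  assumes idem: "\<And>\<U>. \<U> \<in> filters X \<Longrightarrow> up_mult X f \<U> \<U> = \<U>"
  shows "linear_on X f"
  unfolding linear_on_def
proof (intro ballI)
  fix x y assume X: "x \<in> X" "y \<in> X"
  let ?F = "{A. A \<subseteq> X \<and> {x, y} \<subseteq> A}"
  have F: "?F \<in> filters X" using X unfolding filters_def upfamily_def by blast
  then have up: "upfamily X ?F" unfolding filters_def by blast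
  have "{x, y} \<in> up_mult X f ?F ?F" using idem[OF F] X by blast
  then have "translates_in X f {x, y} ?F \<in> ?F" using mem_up_mult[OF up up] by blast
  then have "x \<in> translates_in X f {x, y} ?F" by blast
  then show "f x y \<in> {x, y}" unfolding translates_in_def by blast
qed

text \<open>If \<open>z = xy\<close> is different from \<open>x\<close> and \<open>y\<close>, let \<open>\<M>\<close> consist of the sets with at
  least two elements of \<open>{x, y, z}\<close>. Each translate of \<open>{x, y, z}\<close> by one of its elements
  maps at least two of the three elements to \<open>z\<close>. So \<open>{x, y} \<in> \<M>\<close> fails the test for
  membership in \<open>\<M> * \<M>\<close>.\<close>
lemma linear_if_max_linked_idem:
  assumes sl: "semilattice_on X f"
    and idem: "\<And>\<U>. \<U> \<in> max_linked X \<Longrightarrow> up_mult X f \<U> \<U> = \<U>"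
  shows "linear_on X f"
  unfolding linear_on_def
proof (intro ballI, rule ccontr)
  fix x y assume X: "x \<in> X" "y \<in> X" and ne: "f x y \<notin> {x, y}"
  define z where "z = f x y"
  have zX: "z \<in> X" and com: "f y x = z" and i: "f x x = x" "f y y = y"
    using sl X unfolding semilattice_on_def semigroup_on_def z_def by auto
  have z: "f x z = z" "f y z = z" "f z x = z" "f z y = z" "f z z = z"
    using sl X zX unfolding semilattice_on_def semigroup_on_def z_def by metis+
  have nz: "z \<noteq> x" "z \<noteq> y" using ne unfolding z_def by auto
  have nxy: "x \<noteq> y" using ne i by auto
  let ?M = "{A. A \<subseteq> X \<and> ({x, y} \<subseteq> A \<or> {x, z} \<subseteq> A \<or> {y, z} \<subseteq> A)}"
  have up: "upfamily X ?M" using X zX unfolding upfamily_def by blast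
  have "linked ?M" unfolding linked_def by blast
  moreover have "A \<in> ?M \<or> X - A \<in> ?M" if "A \<subseteq> X" for A using that X zX by blast
  ultimately have M: "?M \<in> max_linked X" using up unfolding mem_max_linked by blast
  have "{x, y} \<in> up_mult X f ?M ?M" using idem[OF M] X by blast
  then have D: "translates_in X f {x, y} ?M \<in> ?M" using mem_up_mult[OF up up] by blast
  have "x \<notin> translates_in X f {x, y} ?M" "y \<notin> translates_in X f {x, y} ?M"
    unfolding translates_in_def using z i com z_def nz nxy by auto
  then show False using D by blast
qed


section \<open>Finiteness\<close>

definition tail_filter :: "'a set \<Rightarrow> (nat \<Rightarrow> 'a) \<Rightarrow> 'a set set" where
  "tail_filter X h = {A. A \<subseteq> X \<and> (\<exists>n. h ` {n..} \<subseteq> A)}"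

lemma tail_filter_in_filters:
  assumes "range h \<subseteq> X"
  shows "tail_filter X h \<in> filters X"
proof -
  have "upfamily X (tail_filter X h)"
    using assms unfolding upfamily_def tail_filter_def by fastforce
  moreover have "A \<inter> B \<in> tail_filter X h"
    if AB: "A \<in> tail_filter X h" "B \<in> tail_filter X h" for A B
  proof -
    obtain m where m: "h ` {m..} \<subseteq> A" "A \<subseteq> X" using AB(1) unfolding tail_filter_def by auto
    obtain n where n: "h ` {n..} \<subseteq> B" using AB(2) unfolding tail_filter_def by auto
    have "h ` {max m n..} \<subseteq> A \<inter> B" using m(1) n by auto
    then show ?thesis using m(2) unfolding tail_filter_def by blast
  qed
  ultimately show ?thesis unfolding filters_def by blast
qed

lemma tail_filter_tail: "range h \<subseteq> X \<Longrightarrow> h ` {n..} \<in> tail_filter X h"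
  unfolding tail_filter_def by blast

text \<open>Colour a pair of indices of an injective sequence by the factor that equals the product, and
  pass to an infinite homogeneous set of indices.\<close>
lemma infinite_linear_sequence:
  assumes inf: "infinite X" and lin: "linear_on X f"
  obtains g :: "nat \<Rightarrow> 'a" where "inj g" "range g \<subseteq> X"
    "(\<forall>m n. m < n \<longrightarrow> f (g m) (g n) = g m) \<or> (\<forall>m n. m < n \<longrightarrow> f (g m) (g n) = g n)"
proof -
  obtain h :: "nat \<Rightarrow> 'a" where h: "inj h" "range h \<subseteq> X"
    using infinite_countable_subset[OF inf] by blast
  define col :: "nat set \<Rightarrow> nat" where
    "col P = (if f (h (Min P)) (h (Max P)) = h (Min P) then 0 else 1)" for P
  have "\<exists>Y t. Y \<subseteq> UNIV \<and> infinite Y \<and> t < 2 \<and> (\<forall>x\<in>Y. \<forall>y\<in>Y. x \<noteq> y \<longrightarrow> col {x, y} = t)"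
    by (rule Ramsey2) (auto simp: col_def)
  then obtain Y t where Y: "infinite Y" "\<forall>x\<in>Y. \<forall>y\<in>Y. x \<noteq> y \<longrightarrow> col {x, y} = t" by blast
  obtain r :: "nat \<Rightarrow> nat" where r: "strict_mono r" "\<forall>n. r n \<in> Y"
    using infinite_enumerate[OF Y(1)] by blast
  let ?g = "h \<circ> r"
  have col: "col {r m, r n} = t" and colv: "col {r m, r n} = (if f (?g m) (?g n) = ?g m then 0 else 1)"
    if "m < n" for m n
  proof -
    have "r m < r n" using r(1) that by (simp add: strict_mono_less)
    then show "col {r m, r n} = t" using Y(2) r(2) by simp
    show "col {r m, r n} = (if f (?g m) (?g n) = ?g m then 0 else 1)"
      using \<open>r m < r n\<close> unfolding col_def by (simp add: max_def min_def)
  qed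
  have "f (?g m) (?g n) \<in> {?g m, ?g n}" for m n
  proof -
    have "?g m \<in> X" "?g n \<in> X" using h(2) by auto
    then show ?thesis using lin unfolding linear_on_def by blast
  qed
  then have "(\<forall>m n. m < n \<longrightarrow> f (?g m) (?g n) = ?g m) \<or> (\<forall>m n. m < n \<longrightarrow> f (?g m) (?g n) = ?g n)"
    using col colv by (metis insertE singletonD zero_neq_one)
  moreover have "inj ?g" using h(1) r(1) by (simp add: inj_compose strict_mono_imp_inj_on)
  moreover have "range ?g \<subseteq> X" using h(2) by auto
  ultimately show ?thesis using that by blast
qed

text \<open>Each term of \<open>g \<circ> p\<close> is followed in \<open>g\<close> by a tail of \<open>g \<circ> q\<close>. So only products of
  a term of \<open>g\<close> with a later one have to lie in \<open>A\<close>. For a monotone sequence in a chain such a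
  product is always the first factor, or always the second, and \<open>A\<close> will be the range of
  \<open>g \<circ> p\<close> or of \<open>g \<circ> q\<close>, respectively.\<close>
lemma mem_up_mult_tails:
  fixes g :: "nat \<Rightarrow> 'a" and p q :: "nat \<Rightarrow> nat"
  assumes U: "upfamily X \<U>" "range (g \<circ> p) \<in> \<U>"
    and V: "upfamily X \<V>" "\<And>n. (g \<circ> q) ` {n..} \<in> \<V>"
    and q: "strict_mono q" and AX: "A \<subseteq> X"
    and A: "\<And>k n. p k < q n \<Longrightarrow> f (g (p k)) (g (q n)) \<in> A"
  shows "A \<in> up_mult X f \<U> \<V>"
proof -
  have "range (g \<circ> p) \<subseteq> translates_in X f A \<V>"
  proof
    fix x assume x: "x \<in> range (g \<circ> p)"
    then obtain k where k: "x = g (p k)" by auto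
    have "(g \<circ> q) ` {Suc (p k)..} \<subseteq> {y \<in> X. f x y \<in> A}"
    proof
      fix y assume y: "y \<in> (g \<circ> q) ` {Suc (p k)..}"
      then obtain n where n: "Suc (p k) \<le> n" "y = g (q n)" by auto
      have "p k < q n" using n(1) strict_mono_imp_increasing[OF q, of n] by simp
      moreover have "y \<in> X" using y upfamily_subset[OF V(1) V(2)] by blast
      ultimately show "y \<in> {y \<in> X. f x y \<in> A}" using A k n by simp
    qed
    then have "{y \<in> X. f x y \<in> A} \<in> \<V>"
      using upfamily_mono[OF V(1) V(2)] by auto
    then show "x \<in> translates_in X f A \<V>"
      using x upfamily_subset[OF U] unfolding translates_in_def by blast
  qed
  then have "translates_in X f A \<V> \<in> \<U>"
    by (rule upfamily_mono[OF U _ translates_in_subset])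
  then show ?thesis using AX by (simp add: mem_up_mult[OF U(1) V(1)])
qed

text \<open>Filters and maximal linked upfamilies are treated alike here. A tail filter is itself a
  filter, while only some extension of it is maximal linked; therefore \<open>tails\<close> asks for an
  inclusion. With \<open>p\<close> and \<open>q\<close> enumerating the even and the odd numbers, \<open>com\<close> collects two
  disjoint sets in one and the same linked family.\<close>
lemma finite_if_commuting_linked:
  assumes lin: "linear_on X f"
    and closed: "\<And>\<U> \<V>. \<U> \<in> K \<Longrightarrow> \<V> \<in> K \<Longrightarrow> up_mult X f \<U> \<V> \<in> K"
    and commute: "\<And>\<U> \<V>. \<U> \<in> K \<Longrightarrow> \<V> \<in> K \<Longrightarrow> up_mult X f \<U> \<V> = up_mult X f \<V> \<U>"
    and linked: "\<And>\<U>. \<U> \<in> K \<Longrightarrow> upfamily X \<U> \<and> linked \<U>"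
    and tails: "\<And>h. range h \<subseteq> X \<Longrightarrow> \<exists>\<U>\<in>K. tail_filter X h \<subseteq> \<U>"
  shows "finite X"
proof (rule ccontr)
  assume "infinite X"
  then obtain g :: "nat \<Rightarrow> 'a" where inj: "inj g" and gX: "range g \<subseteq> X"
    and g: "(\<forall>m n. m < n \<longrightarrow> f (g m) (g n) = g m) \<or> (\<forall>m n. m < n \<longrightarrow> f (g m) (g n) = g n)"
    using infinite_linear_sequence[OF _ lin] by metis
  define p q :: "nat \<Rightarrow> nat" where "p = (\<lambda>n. 2 * n)" and "q = (\<lambda>n. 2 * n + 1)"
  have mono: "strict_mono p" "strict_mono q" unfolding p_def q_def strict_mono_def by auto
  have sub: "range (g \<circ> p) \<subseteq> X" "range (g \<circ> q) \<subseteq> X" using gX by auto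
  obtain \<U> where U: "\<U> \<in> K" "tail_filter X (g \<circ> p) \<subseteq> \<U>" using tails[OF sub(1)] by blast
  obtain \<V> where V: "\<V> \<in> K" "tail_filter X (g \<circ> q) \<subseteq> \<V>" using tails[OF sub(2)] by blast
  have tU: "(g \<circ> p) ` {n..} \<in> \<U>" for n using tail_filter_tail[OF sub(1)] U(2) by blast
  have tV: "(g \<circ> q) ` {n..} \<in> \<V>" for n using tail_filter_tail[OF sub(2)] V(2) by blast
  have rU: "range (g \<circ> p) \<in> \<U>" and rV: "range (g \<circ> q) \<in> \<V>"
    using tU[of 0] tV[of 0] by (simp_all add: atLeast_0)
  have u: "upfamily X \<U>" and v: "upfamily X \<V>" using linked U V by blast+
  have com: "up_mult X f \<U> \<V> = up_mult X f \<V> \<U>" using commute U V by blast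
  have "range (g \<circ> p) \<in> up_mult X f \<U> \<V> \<and> range (g \<circ> q) \<in> up_mult X f \<U> \<V>"
    using g
  proof
    assume "\<forall>m n. m < n \<longrightarrow> f (g m) (g n) = g m"
    then have "range (g \<circ> p) \<in> up_mult X f \<U> \<V>" "range (g \<circ> q) \<in> up_mult X f \<V> \<U>"
      using mem_up_mult_tails[OF u rU v tV mono(2) sub(1)]
        mem_up_mult_tails[OF v rV u tU mono(1) sub(2)] by auto
    with com show ?thesis by simp
  next
    assume "\<forall>m n. m < n \<longrightarrow> f (g m) (g n) = g n"
    then have "range (g \<circ> q) \<in> up_mult X f \<U> \<V>" "range (g \<circ> p) \<in> up_mult X f \<V> \<U>"
      using mem_up_mult_tails[OF u rU v tV mono(2) sub(2)]
        mem_up_mult_tails[OF v rV u tU mono(1) sub(1)] by auto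
    with com show ?thesis by simp
  qed
  then have "range (g \<circ> p) \<inter> range (g \<circ> q) \<noteq> {}"
    using linked[OF closed[OF U(1) V(1)]] unfolding linked_def by blast
  then obtain i j where "g (p i) = g (q j)" by auto
  then have "p i = q j" using inj by (simp add: inj_eq)
  then show False unfolding p_def q_def by presburger
qed


section \<open>The equivalence\<close>

theorem theorem3p1:
  fixes X :: "'a set" and f :: "'a \<Rightarrow> 'a \<Rightarrow> 'a"
  assumes "semigroup_on X f"
  shows "((finite X \<and> semilattice_on X f \<and> linear_on X f)
            \<longleftrightarrow> semilattice_on (upfamilies X) (up_mult X f)) \<and>
         (semilattice_on (upfamilies X) (up_mult X f)
            \<longleftrightarrow> semilattice_on (max_linked X) (up_mult X f)) \<and>
         (semilattice_on (max_linked X) (up_mult X f)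
            \<longleftrightarrow> semilattice_on (filters X) (up_mult X f))"
proof -
  let ?chain = "finite X \<and> semilattice_on X f \<and> linear_on X f"
  have "semilattice_on (upfamilies X) (up_mult X f)" if ?chain
    using semilattice_upfamilies that by blast
  moreover have "semilattice_on (max_linked X) (up_mult X f)"
    if "semilattice_on (upfamilies X) (up_mult X f)"
  proof (rule semilattice_on_subset[OF that])
    show "max_linked X \<subseteq> upfamilies X" unfolding max_linked_def upfamilies_def by blast
  qed (rule max_linked_up_mult[OF assms])
  moreover have "semilattice_on (filters X) (up_mult X f)"
    if "semilattice_on (upfamilies X) (up_mult X f)"
  proof (rule semilattice_on_subset[OF that])
    show "filters X \<subseteq> upfamilies X" unfolding filters_def upfamilies_def by blast
  qed (rule filters_up_mult[OF assms])
  moreover have ?chain if K: "semilattice_on (max_linked X) (up_mult X f)"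
  proof -
    have sl: "semilattice_on X f"
      by (rule semilattice_base[OF assms K principal_max_linked])
    have lin: "linear_on X f"
      using K unfolding semilattice_on_def[of "max_linked X"]
      by (intro linear_if_max_linked_idem[OF sl]) blast
    have "finite X"
    proof (rule finite_if_commuting_linked[OF lin, where K = "max_linked X"])
      show "\<exists>\<U>\<in>max_linked X. tail_filter X h \<subseteq> \<U>" if "range h \<subseteq> X" for h
      proof (rule linked_extends_to_max_linked)
        show "upfamily X (tail_filter X h)"
          using tail_filter_in_filters[OF that] unfolding filters_def by blast
        show "linked (tail_filter X h)"
          by (rule filter_linked[OF tail_filter_in_filters[OF that]])
      qed
    qed (use K max_linked_up_mult[OF assms] in \<open>auto simp: semilattice_on_def mem_max_linked\<close>)
    with sl lin show ?thesis by blast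
  qed
  moreover have ?chain if K: "semilattice_on (filters X) (up_mult X f)"
  proof -
    have sl: "semilattice_on X f"
      by (rule semilattice_base[OF assms K principal_filter])
    have lin: "linear_on X f"
      using K unfolding semilattice_on_def[of "filters X"]
      by (intro linear_if_filters_idem) blast
    have "finite X"
    proof (rule finite_if_commuting_linked[OF lin, where K = "filters X"])
      show "upfamily X \<U> \<and> linked \<U>" if "\<U> \<in> filters X" for \<U>
        using that filter_linked unfolding filters_def by blast
      show "\<exists>\<U>\<in>filters X. tail_filter X h \<subseteq> \<U>" if "range h \<subseteq> X" for h
        using tail_filter_in_filters[OF that] by blast
    qed (use K filters_up_mult[OF assms] in \<open>auto simp: semilattice_on_def\<close>)
    with sl lin show ?thesis by blast
  qed
  ultimately show ?thesis by blast
qed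

end
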